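(* Fix $p\in(0,1]$ and set $y=1-p/2$. For $n\ge 4$ let $\vec G(n,p)$ be the random directed graph on $[n]$ obtained by including each of the $\binom n2$ edges independently with probability $p$ and then orienting each included edge independently in either direction with probability $1/2$. Let $a,s,b,t$ be four distinct fixed vertices, $A$ the event that there is no directed path from $s$ to $a$, and $B$ the event that there is no directed path from $t$ to $b$. Then $$\lim_{n\to\infty}\frac{\mathbb{P}(A\cap B)}{y^{2n-4}}=4-p.$$
   Context: Probabilities are taken in the joint probability space of the random graph and the random orientations (the "annealed" model). *)

theory Defs
  imports "HOL-Probability.Probability" "Graph_Theory.Arc_Walk"
begin

text \<open>The edge \<open>{i, j}\<close> of the complete graph on \<open>[n]\<close> is represented by the pair
  \<open>(i, j)\<close> with \<open>i < j\<close>.\<close>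

definition all_edges :: "nat \<Rightarrow> (nat \<times> nat) set" where
  "all_edges n = {(i, j). i \<in> {1..n} \<and> j \<in> {1..n} \<and> i < j}"

definition random_edges :: "nat \<Rightarrow> real \<Rightarrow> (nat \<times> nat) set pmf" where
  "random_edges n p =
     map_pmf (\<lambda>X. {e \<in> all_edges n. X e})
       (Pi_pmf (all_edges n) False (\<lambda>_. bernoulli_pmf p))"

text \<open>A fair coin for each edge \<open>(i, j)\<close> with \<open>i < j\<close> decides between the arcs
  \<open>(i, j)\<close> and \<open>(j, i)\<close>.\<close>

definition random_orientation :: "(nat \<times> nat) set \<Rightarrow> (nat \<times> nat) set pmf" where
  "random_orientation E =
     map_pmf (\<lambda>c. (\<lambda>e. if c e then e else prod.swap e) ` E)
       (Pi_pmf E False (\<lambda>_. bernoulli_pmf (1 / 2)))"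

text \<open>The annealed law: both the edges and their orientations are random.\<close>

definition random_digraph :: "nat \<Rightarrow> real \<Rightarrow> (nat, nat \<times> nat) pre_digraph pmf" where
  "random_digraph n p =
     do {
       E \<leftarrow> random_edges n p;
       D \<leftarrow> random_orientation E;
       return_pmf \<lparr>verts = {1..n}, arcs = D, tail = fst, head = snd\<rparr>
     }"

definition no_dipath :: "'a \<Rightarrow> 'a \<Rightarrow> ('a, 'b) pre_digraph set" where
  "no_dipath u v = {G. \<not> (\<exists>\<pi>. pre_digraph.apath G u \<pi> v)}"

end

theory Submission
  imports Defs
begin

text \<open>
  There is no directed path from \<open>u\<close> to \<open>v\<close> iff some vertex set containing \<open>u\<close> but not \<open>v\<close>
  has no outgoing arcs; call such a set closed. Writing \<open>y = 1 - p / 2\<close>, a set \<open>F\<close> of ordered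
  pairs contains no arc with probability at most \<open>y\<^bsup>|F|\<^esup>\<close>, with equality if \<open>F\<close> contains
  no two opposite pairs, because \<open>1 - p \<le> y\<^sup>2\<close>.

  Up to probability \<open>O(n\<^sup>4 y\<^bsup>3n\<^esup>)\<close> every closed set has at most 2 or at least \<open>n - 2\<close> elements.
  Closed sets are stable under union and intersection, so if \<open>S\<close> separates \<open>s\<close> from \<open>a\<close> and \<open>T\<close>
  separates \<open>t\<close> from \<open>b\<close>, then \<open>S \<union> T = {s, t}\<close> if both are small, and \<open>S \<inter> T\<close> is the complement of
  \<open>{a, b}\<close> if both are large. If \<open>S\<close> is small and \<open>T\<close> large, then \<open>S = {s}\<close> and \<open>T\<close> is the
  complement of \<open>{b}\<close>, since larger \<open>S\<close> or smaller \<open>T\<close> forbid about \<open>3n\<close> arcs. The four cases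
  have probabilities \<open>y\<^bsup>2n-4\<^esup>\<close>, \<open>y\<^bsup>2n-4\<^esup>\<close>, \<open>y\<^bsup>2n-3\<^esup>\<close> and \<open>y\<^bsup>2n-3\<^esup>\<close>, overlap with
  probability \<open>O(y\<^bsup>3n\<^esup>)\<close>, and \<open>2 + 2y = 4 - p\<close>.
\<close>

section \<open>Probability that a given set of arcs is absent\<close>

definition arc_free :: "(nat \<times> nat) set \<Rightarrow> (nat, nat \<times> nat) pre_digraph set" where
  "arc_free F = {G. arcs G \<inter> F = {}}"

definition out_cut :: "nat \<Rightarrow> nat set \<Rightarrow> (nat \<times> nat) set" where
  "out_cut n S = S \<times> ({1..n} - S)"

lemma finite_all_edges: "finite (all_edges n)"
  by (rule finite_subset[of _ "{1..n} \<times> {1..n}"]) (auto simp: all_edges_def)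

lemma prob_bernoulli_half_branch:
  "measure_pmf.prob (bernoulli_pmf (1 / 2)) {c. if c then P else Q}
     = 1 - (of_bool (\<not> P) + of_bool (\<not> Q)) / 2"
proof -
  have "measure_pmf.prob (bernoulli_pmf (1 / 2)) {c. if c then P else Q}
      = (\<Sum>c\<in>{c. if c then P else Q}. pmf (bernoulli_pmf (1 / 2)) c)"
    by (rule measure_measure_pmf_finite) simp
  also have "\<dots> = (\<Sum>c\<in>UNIV. if (if c then P else Q) then 1 / 2 else 0)"
    by (rule sum.mono_neutral_cong_left) (auto split: if_splits)
  finally show ?thesis
    by (simp add: UNIV_bool)
qed

text \<open>The coins are independent, so the probability factors over the edges. An edge avoids
  \<open>F\<close> with probability 1, 1/2 or 0 according to how many of its two orientations lie in
  \<open>F\<close>.\<close>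

lemma prob_orientation_avoids:
  assumes "E \<subseteq> all_edges n"
  shows "measure_pmf.prob (random_orientation E) {D. D \<inter> F = {}}
           = (\<Prod>e\<in>E. 1 - real (card (F \<inter> {e, prod.swap e})) / 2)"
proof -
  have fin: "finite E"
    using assms finite_all_edges by (rule finite_subset)
  have "measure_pmf.prob (random_orientation E) {D. D \<inter> F = {}}
      = measure_pmf.prob (Pi_pmf E False (\<lambda>_. bernoulli_pmf (1 / 2)))
          (Pi E (\<lambda>e. {c. if c then e \<notin> F else prod.swap e \<notin> F}))"
    unfolding random_orientation_def measure_map_pmf
    by (rule arg_cong[where f = "measure_pmf.prob _"]) (auto simp: Pi_def split: if_splits)
  also have "\<dots> = (\<Prod>e\<in>E. measure_pmf.prob (bernoulli_pmf (1 / 2))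
                     {c. if c then e \<notin> F else prod.swap e \<notin> F})"
    by (rule measure_Pi_pmf_Pi) (rule fin)
  also have "\<dots> = (\<Prod>e\<in>E. 1 - real (card (F \<inter> {e, prod.swap e})) / 2)"
  proof (rule prod.cong[OF refl])
    fix e assume "e \<in> E"
    \<comment> \<open>\<open>i < j\<close> makes the two orientations distinct, so the cardinality
      is a sum of two indicators.\<close>
    then have "e \<noteq> prod.swap e"
      using assms by (auto simp: all_edges_def)
    then have "card (F \<inter> {e, prod.swap e}) = of_bool (e \<in> F) + of_bool (prod.swap e \<in> F)"
      by (auto simp: Int_insert_right)
    then show "measure_pmf.prob (bernoulli_pmf (1 / 2)) {c. if c then e \<notin> F else prod.swap e \<notin> F}
        = 1 - real (card (F \<inter> {e, prod.swap e})) / 2"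
      by (simp add: prob_bernoulli_half_branch)
  qed
  finally show ?thesis .
qed

lemma card_swap_pair_le: "card (F \<inter> {e, prod.swap e}) \<le> 2"
  by (rule order_trans[OF card_mono[of "{e, prod.swap e}"]]) (auto simp: card_insert_le_m1)

text \<open>Conditioning on the edge set gives a product over the present edges. Letting absent
  edges contribute the factor 1 turns it into a product over all edges of functions of independent
  coins, so the expectation factors into terms \<open>p * h e + (1 - p)\<close>.\<close>

lemma prob_arc_free:
  assumes "0 \<le> p" "p \<le> 1"
  shows "measure_pmf.prob (random_digraph n p) (arc_free F)
           = (\<Prod>e\<in>all_edges n. 1 - p / 2 * card (F \<inter> {e, prod.swap e}))"
proof -
  \<comment> \<open>\<open>h e\<close> is the probability that the edge \<open>e\<close>, once
    present, is oriented outside \<open>F\<close>.\<close>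
  define h where "h = (\<lambda>e. 1 - real (card (F \<inter> {e, prod.swap e})) / 2)"
  have h0: "h e \<ge> 0" for e
    using card_swap_pair_le[of F e] by (simp add: h_def)
  have orient: "emeasure (measure_pmf (random_orientation E))
      {D. D \<inter> F = {}} = (\<Prod>e\<in>E. ennreal (h e))" if "E \<subseteq> all_edges n" for E
    using prob_orientation_avoids[OF that, of F]
    by (simp add: measure_pmf.emeasure_eq_measure prod_ennreal h0) (simp add: h_def)
  have pre: "(\<lambda>D. \<lparr>verts = {1..n}, arcs = D, tail = fst, head = snd\<rparr>) -` arc_free F
      = {D. D \<inter> F = {}}"
    by (auto simp: arc_free_def)
  have "emeasure (measure_pmf (random_digraph n p)) (arc_free F)
      = (\<integral>\<^sup>+E. emeasure (measure_pmf (random_orientation E)) {D. D \<inter> F = {}}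
           \<partial>measure_pmf (random_edges n p))"
    unfolding random_digraph_def map_pmf_def[symmetric] emeasure_bind_pmf emeasure_map_pmf pre ..
  also have "\<dots> = (\<integral>\<^sup>+X. (\<Prod>e\<in>{e \<in> all_edges n. X e}. ennreal (h e))
           \<partial>measure_pmf (Pi_pmf (all_edges n) False (\<lambda>_. bernoulli_pmf p)))"
    unfolding random_edges_def by (simp add: orient)
  also have "\<dots> = (\<integral>\<^sup>+X. (\<Prod>e\<in>all_edges n. if X e then ennreal (h e) else 1)
           \<partial>measure_pmf (Pi_pmf (all_edges n) False (\<lambda>_. bernoulli_pmf p)))"
    by (simp add: prod.inter_filter[OF finite_all_edges])
  also have "\<dots> = (\<Prod>e\<in>all_edges n.
      \<integral>\<^sup>+x. (if x then ennreal (h e) else 1) \<partial>measure_pmf (bernoulli_pmf p))"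
    by (rule nn_integral_prod_Pi_pmf[OF finite_all_edges,
          where f = "\<lambda>e x. if x then ennreal (h e) else 1"])
  also have "\<dots> = (\<Prod>e\<in>all_edges n. ennreal (p * h e + (1 - p)))"
    using assms h0
    by (intro prod.cong refl)
       (simp add: nn_integral_bernoulli_pmf ennreal_mult mult.commute)
  also have "\<dots> = ennreal (\<Prod>e\<in>all_edges n. p * h e + (1 - p))"
    using assms h0 by (intro prod_ennreal) auto
  finally have "measure_pmf.prob (random_digraph n p) (arc_free F)
      = (\<Prod>e\<in>all_edges n. p * h e + (1 - p))"
    using assms h0
    by (simp add: measure_pmf.emeasure_eq_measure prod_nonneg)
  also have "\<dots> = (\<Prod>e\<in>all_edges n. 1 - p / 2 * card (F \<inter> {e, prod.swap e}))"
    by (intro prod.cong refl) (simp add: h_def field_simps)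
  finally show ?thesis .
qed

text \<open>The loopless pairs are partitioned into the classes \<open>{e, prod.swap e}\<close>,
  each represented by its increasing member.\<close>

lemma sum_card_swap_pair:
  assumes "F \<subseteq> {1..n} \<times> {1..n} - Id"
  shows "(\<Sum>e\<in>all_edges n. card (F \<inter> {e, prod.swap e})) = card F"
proof -
  have "F = (\<Union>e\<in>all_edges n. F \<inter> {e, prod.swap e})"
  proof (intro equalityI subsetI)
    fix e assume e: "e \<in> F"
    obtain u v where uv: "e = (u, v)" by fastforce
    then consider "u < v" | "v < u"
      using e assms by force
    then show "e \<in> (\<Union>e\<in>all_edges n. F \<inter> {e, prod.swap e})"
    proof cases
      case 1
      then have "(u, v) \<in> all_edges n" using e uv assms by (auto simp: all_edges_def)
      then show ?thesis by (rule UN_I) (use e uv in auto)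
    next
      case 2
      then have "(v, u) \<in> all_edges n" using e uv assms by (auto simp: all_edges_def)
      then show ?thesis by (rule UN_I) (use e uv in auto)
    qed
  qed auto
  then have "card F = card (\<Union>e\<in>all_edges n. F \<inter> {e, prod.swap e})"
    by simp
  also have "\<dots> = (\<Sum>e\<in>all_edges n. card (F \<inter> {e, prod.swap e}))"
    by (rule card_UN_disjoint) (auto simp: finite_all_edges, auto simp: all_edges_def)
  finally show ?thesis ..
qed

text \<open>Compare edge by edge: a factor with \<open>k\<close> forbidden orientations is
  \<open>1 - k * p / 2\<close>, which equals the \<open>k\<close>-th power of
  \<open>1 - p / 2\<close> for \<open>k \<le> 1\<close>, while for \<open>k = 2\<close> it is
  \<open>1 - p \<le> (1 - p / 2)^2\<close>.\<close>

lemma prob_arc_free_le: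
  assumes "0 \<le> p" "p \<le> 1" and F: "F \<subseteq> {1..n} \<times> {1..n} - Id" and "m \<le> card F"
  shows "measure_pmf.prob (random_digraph n p) (arc_free F) \<le> (1 - p / 2) ^ m"
proof -
  have edge: "0 \<le> 1 - p / 2 * card (F \<inter> {e, prod.swap e}) \<and>
    1 - p / 2 * card (F \<inter> {e, prod.swap e}) \<le> (1 - p / 2) ^ card (F \<inter> {e, prod.swap e})" for e
  proof -
    define k where "k = card (F \<inter> {e, prod.swap e})"
    have "k \<le> 2"
      unfolding k_def by (rule card_swap_pair_le)
    then have "k = 0 \<or> k = 1 \<or> k = 2"
      by linarith
    then show ?thesis
      using assms(1,2) unfolding k_def[symmetric]
      by (auto simp: power2_eq_square algebra_simps)
  qed
  have "measure_pmf.prob (random_digraph n p) (arc_free F)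
      \<le> (\<Prod>e\<in>all_edges n. (1 - p / 2) ^ card (F \<inter> {e, prod.swap e}))"
    unfolding prob_arc_free[OF assms(1,2)] using edge by (intro prod_mono) auto
  also have "\<dots> = (1 - p / 2) ^ card F"
    by (simp add: power_sum[symmetric] sum_card_swap_pair[OF F])
  also have "\<dots> \<le> (1 - p / 2) ^ m"
    using assms by (intro power_decreasing) auto
  finally show ?thesis .
qed

text \<open>Without opposite pairs the lossy case \<open>k = 2\<close> never occurs.\<close>

lemma prob_arc_free_asym:
  assumes "0 \<le> p" "p \<le> 1" and F: "F \<subseteq> {1..n} \<times> {1..n}" and asym: "F \<inter> F\<inverse> = {}"
  shows "measure_pmf.prob (random_digraph n p) (arc_free F) = (1 - p / 2) ^ card F"
proof -
  have F': "F \<subseteq> {1..n} \<times> {1..n} - Id"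
    using F asym by auto
  have edge: "1 - p / 2 * card (F \<inter> {e, prod.swap e}) = (1 - p / 2) ^ card (F \<inter> {e, prod.swap e})"
    if "e \<in> all_edges n" for e
  proof -
    have "\<not> (e \<in> F \<and> prod.swap e \<in> F)"
      using asym by (cases e) auto
    then show ?thesis by (auto simp: Int_insert_right)
  qed
  have "measure_pmf.prob (random_digraph n p) (arc_free F)
      = (\<Prod>e\<in>all_edges n. (1 - p / 2) ^ card (F \<inter> {e, prod.swap e}))"
    unfolding prob_arc_free[OF assms(1,2)] using edge by (intro prod.cong) auto
  then show ?thesis
    by (simp add: power_sum[symmetric] sum_card_swap_pair[OF F'])
qed

section \<open>Directed paths and closed vertex sets\<close>

lemma random_digraph_support:
  assumes "G \<in> set_pmf (random_digraph n p)"
  shows "verts G = {1..n}" "tail G = fst" "head G = snd" "arcs G \<subseteq> {1..n} \<times> {1..n}"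
proof -
  from assms obtain E D where E: "E \<in> set_pmf (random_edges n p)"
    and D: "D \<in> set_pmf (random_orientation E)"
    and G: "G = \<lparr>verts = {1..n}, arcs = D, tail = fst, head = snd\<rparr>"
    by (auto simp: random_digraph_def)
  have "E \<subseteq> all_edges n"
    using E by (auto simp: random_edges_def)
  then have "D \<subseteq> {1..n} \<times> {1..n}"
    using D by (fastforce simp: random_orientation_def all_edges_def)
  then show "verts G = {1..n}" "tail G = fst" "head G = snd" "arcs G \<subseteq> {1..n} \<times> {1..n}"
    using G by auto
qed

text \<open>The set of vertices reachable from \<open>u\<close> is closed, and it misses
  \<open>v\<close> because any walk to \<open>v\<close> could be shortened to a path. Conversely, a
  walk starting in a closed set never leaves it.\<close>

lemma (in wf_digraph) no_dipath_iff_closed: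
  assumes "u \<in> verts G"
  shows "G \<in> no_dipath u v \<longleftrightarrow>
    (\<exists>S\<subseteq>verts G. u \<in> S \<and> v \<notin> S \<and> (\<forall>e\<in>arcs G. tail G e \<in> S \<longrightarrow> head G e \<in> S))"
proof
  assume no: "G \<in> no_dipath u v"
  define S where "S = {w. u \<rightarrow>\<^sup>* w}"
  have "v \<notin> S"
    using no by (auto simp: S_def no_dipath_def reachable_awalk dest: apath_awalk_to_apath)
  moreover have "S \<subseteq> verts G"
    by (auto simp: S_def dest: reachable_in_verts)
  moreover have "u \<in> S"
    using assms by (simp add: S_def)
  moreover have "head G e \<in> S" if "e \<in> arcs G" "tail G e \<in> S" for e
    using that by (auto simp: S_def intro: reachable_adj_trans in_arcs_imp_in_arcs_ends)
  ultimately show "\<exists>S\<subseteq>verts G. u \<in> S \<and> v \<notin> S \<and>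
      (\<forall>e\<in>arcs G. tail G e \<in> S \<longrightarrow> head G e \<in> S)"
    by blast
next
  assume "\<exists>S\<subseteq>verts G. u \<in> S \<and> v \<notin> S \<and> (\<forall>e\<in>arcs G. tail G e \<in> S \<longrightarrow> head G e \<in> S)"
  then obtain S where S: "u \<in> S" "v \<notin> S"
      "\<And>e. e \<in> arcs G \<Longrightarrow> tail G e \<in> S \<Longrightarrow> head G e \<in> S"
    by blast
  have "awalk x \<pi> w \<Longrightarrow> x \<in> S \<Longrightarrow> w \<in> S" for x \<pi> w
    by (induction \<pi> arbitrary: x) (auto simp: awalk_simps S(3))
  then show "G \<in> no_dipath u v"
    using S(1,2) by (auto simp: no_dipath_def apath_def)
qed

lemma no_dipath_iff_arc_free:
  assumes G: "G \<in> set_pmf (random_digraph n p)" and u: "u \<in> {1..n}"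
  shows "G \<in> no_dipath u v \<longleftrightarrow>
    (\<exists>S\<subseteq>{1..n}. u \<in> S \<and> v \<notin> S \<and> G \<in> arc_free (out_cut n S))"
proof -
  note supp = random_digraph_support[OF G]
  interpret wf_digraph G
    by unfold_locales (use supp in auto)
  have "(\<forall>e\<in>arcs G. tail G e \<in> S \<longrightarrow> head G e \<in> S) \<longleftrightarrow> G \<in> arc_free (out_cut n S)" for S
    unfolding arc_free_def out_cut_def using supp by fastforce
  then show ?thesis
    using no_dipath_iff_closed[of u v] u supp(1) by simp
qed

section \<open>Classification of pairs of separating closed sets\<close>

lemma arc_free_Un: "arc_free (F \<union> F') = arc_free F \<inter> arc_free F'"
  by (auto simp: arc_free_def)

lemma arc_free_antimono: "F' \<subseteq> F \<Longrightarrow> arc_free F \<subseteq> arc_free F'"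
  by (auto simp: arc_free_def)

lemma arc_free_out_cut_Un:
  "G \<in> arc_free (out_cut n S) \<Longrightarrow> G \<in> arc_free (out_cut n T) \<Longrightarrow> G \<in> arc_free (out_cut n (S \<union> T))"
  by (fastforce simp: arc_free_def out_cut_def)

lemma arc_free_out_cut_Int:
  "G \<in> arc_free (out_cut n S) \<Longrightarrow> G \<in> arc_free (out_cut n T) \<Longrightarrow> G \<in> arc_free (out_cut n (S \<inter> T))"
  by (fastforce simp: arc_free_def out_cut_def)

lemma card_out_cut:
  assumes "S \<subseteq> {1..n}"
  shows "card (out_cut n S) = card S * (n - card S)"
  using assms by (simp add: out_cut_def card_cartesian_product card_Diff_subset finite_subset)

text \<open>A large closed set is described by its small complement \<open>R\<close>: the second cut
  consists of the arcs entering \<open>R\<close>.\<close>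

definition no_out_no_in :: "nat \<Rightarrow> nat set \<Rightarrow> nat set \<Rightarrow> (nat, nat \<times> nat) pre_digraph set" where
  "no_out_no_in n S R = arc_free (out_cut n S \<union> out_cut n ({1..n} - R))"

text \<open>Sizes 1 and 2 and their complements are left out because their cuts have only
  \<open>n - 1\<close> and \<open>2 * n - 4\<close> arcs; from size 3 on a cut has at least
  \<open>3 * (n - 3)\<close>.\<close>

definition medium_sets :: "nat \<Rightarrow> nat set set" where
  "medium_sets n = {S. S \<subseteq> {1..n} \<and> 3 \<le> card S \<and> card S \<le> n - 3}"

text \<open>The last condition leaves out two singletons, whose cuts together have only about
  \<open>2 * n\<close> arcs and contribute to the main term.\<close>

definition small_pairs :: "nat \<Rightarrow> (nat set \<times> nat set) set" where
  "small_pairs n = {(S, R). S \<subseteq> {1..n} \<and> R \<subseteq> {1..n} \<and> card S \<in> {1, 2} \<and> card R \<in> {1, 2}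
     \<and> card S + card R \<ge> 3}"

definition atypical :: "nat \<Rightarrow> (nat, nat \<times> nat) pre_digraph set" where
  "atypical n = (\<Union>S\<in>medium_sets n. arc_free (out_cut n S))
     \<union> (\<Union>(S, R)\<in>small_pairs n. no_out_no_in n S R)"

definition typical :: "nat \<Rightarrow> nat \<Rightarrow> nat \<Rightarrow> nat \<Rightarrow> nat \<Rightarrow> (nat, nat \<times> nat) pre_digraph set" where
  "typical n s a t b = arc_free (out_cut n {s, t}) \<union> arc_free (out_cut n ({1..n} - {a, b}))
     \<union> no_out_no_in n {s} {b} \<union> no_out_no_in n {t} {a}"

lemma no_out_no_in_cases:
  assumes S: "S \<subseteq> {1..n}" "s \<in> S" "card S \<le> 2" and R: "R \<subseteq> {1..n}" "b \<in> R" "card R \<le> 2"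
    and "G \<in> no_out_no_in n S R"
  shows "G \<in> no_out_no_in n {s} {b} \<union> atypical n"
proof (cases "card S = 1 \<and> card R = 1")
  case True
  then have "S = {s}" "R = {b}"
    using S(2) R(2) by (auto simp: card_1_singleton_iff)
  then show ?thesis
    using assms(7) by simp
next
  case False
  have "finite S" "finite R"
    using S(1) R(1) finite_subset by blast+
  then have "card S \<noteq> 0" "card R \<noteq> 0"
    using S(2) R(2) by auto
  then have "(S, R) \<in> small_pairs n"
    using False S R by (auto simp: small_pairs_def)
  then show ?thesis
    using assms(7) by (auto simp: atypical_def)
qed

text \<open>Outside \<open>atypical\<close> every closed set or its complement has at most two
  elements, which leaves four combinations for \<open>S\<close> and \<open>T\<close>. Equal types
  are merged by union or intersection; mixed types reduce to singletons.\<close>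

lemma closed_pair_cases:
  assumes n: "n \<ge> 9" and dist: "distinct [a, s, b, t]" and V: "{a, s, b, t} \<subseteq> {1..n}"
    and S: "S \<subseteq> {1..n}" "s \<in> S" "a \<notin> S" "G \<in> arc_free (out_cut n S)"
    and T: "T \<subseteq> {1..n}" "t \<in> T" "b \<notin> T" "G \<in> arc_free (out_cut n T)"
  shows "G \<in> typical n s a t b \<union> atypical n"
proof (rule ccontr)
  assume contr: "\<not> ?thesis"
  have extreme: "card U \<le> 2 \<or> card ({1..n} - U) \<le> 2"
    if U: "U \<subseteq> {1..n}" "G \<in> arc_free (out_cut n U)" for U
  proof -
    have "U \<notin> medium_sets n"
      using U contr by (auto simp: atypical_def)
    moreover have "card ({1..n} - U) = n - card U"
      using U(1) by (simp add: card_Diff_subset finite_subset)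
    ultimately show ?thesis
      using U(1) by (auto simp: medium_sets_def)
  qed
  have fin: "finite S" "finite T"
    using S(1) T(1) finite_subset by blast+
  have co: "{1..n} - ({1..n} - S) = S" "{1..n} - ({1..n} - T) = T"
    using S(1) T(1) by auto
  consider "card S \<le> 2" "card T \<le> 2" | "card ({1..n} - S) \<le> 2" "card ({1..n} - T) \<le> 2"
    | "card S \<le> 2" "card ({1..n} - T) \<le> 2" | "card T \<le> 2" "card ({1..n} - S) \<le> 2"
    using extreme[OF S(1,4)] extreme[OF T(1,4)] by blast
  then show False
  proof cases
    case 1
    have G: "G \<in> arc_free (out_cut n (S \<union> T))"
      using arc_free_out_cut_Un S(4) T(4) .
    have "card (S \<union> T) \<le> 4"
      using card_Un_le[of S T] 1 by linarith
    moreover have "card ({1..n} - (S \<union> T)) = n - card (S \<union> T)"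
      using S(1) T(1) fin by (subst card_Diff_subset) auto
    \<comment> \<open>As \<open>n \<ge> 9\<close>, the complement of a set of at most four elements
      has at least five, so \<open>extreme\<close> must hold through its first alternative.\<close>
    ultimately have "card (S \<union> T) \<le> 2"
      using extreme[OF _ G] S(1) T(1) n by auto
    then have "{s, t} = S \<union> T"
      using S(2) T(2) dist fin by (intro card_seteq) auto
    then show False
      using G contr by (simp add: typical_def)
  next
    case 2
    have G: "G \<in> arc_free (out_cut n (S \<inter> T))"
      using arc_free_out_cut_Int S(4) T(4) .
    have "{1..n} - S \<inter> T = ({1..n} - S) \<union> ({1..n} - T)"
      by auto
    then have "card ({1..n} - S \<inter> T) \<le> 4"
      using card_Un_le[of "{1..n} - S" "{1..n} - T"] 2 by simp
    moreover have "card ({1..n} - S \<inter> T) = n - card (S \<inter> T)"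
      using S(1) fin by (subst card_Diff_subset) auto
    moreover have "S \<inter> T \<subseteq> {1..n}"
      using S(1) by auto
    \<comment> \<open>The same argument applied to the complements, which unite to at most four
      elements.\<close>
    ultimately have "card ({1..n} - S \<inter> T) \<le> 2"
      using extreme[OF _ G] n by auto
    then have "{a, b} = {1..n} - S \<inter> T"
      using S(3) T(3) dist V by (intro card_seteq) auto
    then have "S \<inter> T = {1..n} - {a, b}"
      using S(1) T(1) by auto
    then show False
      using G contr by (simp add: typical_def)
  next
    case 3
    have "G \<in> no_out_no_in n {s} {b} \<union> atypical n"
      using 3 S T V co
      by (intro no_out_no_in_cases[of S n s "{1..n} - T" b])
         (auto simp: no_out_no_in_def arc_free_Un)
    then show False
      using contr by (auto simp: typical_def)
  next
    case 4
    have "G \<in> no_out_no_in n {t} {a} \<union> atypical n"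
      using 4 S T V co
      by (intro no_out_no_in_cases[of T n t "{1..n} - S" a])
         (auto simp: no_out_no_in_def arc_free_Un)
    then show False
      using contr by (auto simp: typical_def)
  qed
qed

lemma typical_subset_no_dipath:
  assumes G: "G \<in> set_pmf (random_digraph n p)" "G \<in> typical n s a t b"
    and dist: "distinct [a, s, b, t]" and V: "{a, s, b, t} \<subseteq> {1..n}"
  shows "G \<in> no_dipath s a \<inter> no_dipath t b"
proof -
  have closed: "G \<in> no_dipath u v"
    if "S \<subseteq> {1..n}" "G \<in> arc_free (out_cut n S)" "u \<in> S" "v \<notin> S" for u v S
    using that no_dipath_iff_arc_free[OF G(1), of u v] by blast
  \<comment> \<open>\<open>{u}\<close> separates \<open>u\<close> from \<open>v\<close>, and the
    complement of \<open>{x}\<close> separates \<open>w\<close> from \<open>x\<close>.\<close>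
  have ss: "G \<in> no_dipath u v \<and> G \<in> no_dipath w x"
    if "G \<in> no_out_no_in n {u} {x}" "u \<noteq> v" "w \<noteq> x" "u \<in> {1..n}" "w \<in> {1..n}" for u v w x
    using that closed[of "{u}" u v] closed[of "{1..n} - {x}" w x]
    by (auto simp: no_out_no_in_def arc_free_Un)
  from G(2) consider "G \<in> arc_free (out_cut n {s, t})" | "G \<in> arc_free (out_cut n ({1..n} - {a, b}))"
    | "G \<in> no_out_no_in n {s} {b}" | "G \<in> no_out_no_in n {t} {a}"
    by (auto simp: typical_def)
  then show ?thesis
  proof cases
    case 1
    then show ?thesis using closed[of "{s, t}"] dist V by auto
  next
    case 2
    then show ?thesis using closed[of "{1..n} - {a, b}"] dist V by auto
  next
    case 3
    then show ?thesis using ss[of s b a t] dist V by auto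
  next
    case 4
    then show ?thesis using ss[of t a b s] dist V by auto
  qed
qed

lemma no_dipath_subset_typical:
  assumes n: "n \<ge> 9" and G: "G \<in> set_pmf (random_digraph n p)" "G \<in> no_dipath s a \<inter> no_dipath t b"
    and dist: "distinct [a, s, b, t]" and V: "{a, s, b, t} \<subseteq> {1..n}"
  shows "G \<in> typical n s a t b \<union> atypical n"
proof -
  obtain S T where "S \<subseteq> {1..n}" "s \<in> S" "a \<notin> S" "G \<in> arc_free (out_cut n S)"
    and "T \<subseteq> {1..n}" "t \<in> T" "b \<notin> T" "G \<in> arc_free (out_cut n T)"
    using G(2) V no_dipath_iff_arc_free[OF G(1)] by auto
  then show ?thesis
    using closed_pair_cases[OF n dist V] by blast
qed

section \<open>Cut sizes and the probability of the typical event\<close>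

lemma out_cut_subset: "S \<subseteq> {1..n} \<Longrightarrow> out_cut n S \<subseteq> {1..n} \<times> {1..n} - Id"
  by (auto simp: out_cut_def)

text \<open>Inclusion-exclusion: an arc that leaves \<open>S\<close> and enters \<open>R\<close>
  from outside goes from \<open>S - R\<close> to \<open>R - S\<close>.\<close>

lemma card_two_out_cuts:
  assumes "S \<subseteq> {1..n}" "R \<subseteq> {1..n}"
  shows "card (out_cut n S \<union> out_cut n ({1..n} - R)) + card (S - R) * card (R - S)
           = card S * (n - card S) + card R * (n - card R)"
proof -
  have fin: "finite S" "finite R"
    using assms finite_subset by blast+
  have "{1..n} - ({1..n} - R) = R"
    using assms by auto
  then have "out_cut n S \<inter> out_cut n ({1..n} - R) = (S - R) \<times> (R - S)"
    using assms by (auto simp: out_cut_def)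
  moreover have "card (out_cut n ({1..n} - R)) = card R * (n - card R)"
    using assms fin card_mono[OF _ assms(2)]
    by (simp add: card_out_cut card_Diff_subset)
  moreover have "finite (out_cut n S)" "finite (out_cut n ({1..n} - R))"
    using fin by (auto simp: out_cut_def)
  ultimately show ?thesis
    using card_Un_Int[of "out_cut n S" "out_cut n ({1..n} - R)"] card_out_cut[OF assms(1)]
    by (simp add: card_cartesian_product)
qed

text \<open>The stars out of \<open>u\<close> and into \<open>v\<close> have \<open>n - 1\<close>
  arcs each and share \<open>(u, v)\<close>; they contain no opposite pairs, so the probability is
  exact.\<close>

lemma prob_no_out_no_in:
  assumes "0 \<le> p" "p \<le> 1" "u \<in> {1..n}" "v \<in> {1..n}" "u \<noteq> v"
  shows "measure_pmf.prob (random_digraph n p) (no_out_no_in n {u} {v}) = (1 - p / 2) ^ (2 * n - 3)"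
proof -
  define F where "F = out_cut n {u} \<union> out_cut n ({1..n} - {v})"
  have "card F = 2 * n - 3"
    using card_two_out_cuts[of "{u}" n "{v}"] assms by (simp add: F_def)
  moreover have "F \<subseteq> {1..n} \<times> {1..n}" "F \<inter> F\<inverse> = {}"
    using assms by (auto simp: F_def out_cut_def)
  ultimately show ?thesis
    using prob_arc_free_asym[OF assms(1,2), of F n] by (simp add: no_out_no_in_def F_def)
qed

lemma prob_out_cut:
  assumes "0 \<le> p" "p \<le> 1" "S \<subseteq> {1..n}"
  shows "measure_pmf.prob (random_digraph n p) (arc_free (out_cut n S))
           = (1 - p / 2) ^ (card S * (n - card S))"
  using prob_arc_free_asym[OF assms(1,2), of "out_cut n S" n] assms(3)
  by (simp add: card_out_cut) (auto simp: out_cut_def)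

lemma prob_typical_parts:
  fixes p :: real
  assumes p: "0 < p" "p \<le> 1"
    and dist: "distinct [a, s, b, t]" and V: "{a, s, b, t} \<subseteq> {1..n}"
  shows "measure_pmf.prob (random_digraph n p) (arc_free (out_cut n {s, t}))
    + measure_pmf.prob (random_digraph n p) (arc_free (out_cut n ({1..n} - {a, b})))
    + measure_pmf.prob (random_digraph n p) (no_out_no_in n {s} {b})
    + measure_pmf.prob (random_digraph n p) (no_out_no_in n {t} {a})
    = (4 - p) * (1 - p / 2) ^ (2 * n - 4)"
proof -
  have "card {a, s, b, t} \<le> card {1..n}"
    using V by (intro card_mono) auto
  then have n: "n \<ge> 4"
    using dist by simp
  \<comment> \<open>The successor form pulls out one factor \<open>1 - p / 2\<close> from the two
    mixed events, giving \<open>2 + 2 * (1 - p / 2) = 4 - p\<close>.\<close>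
  have exps: "2 * (n - 2) = 2 * n - 4" "2 * n - 3 = Suc (2 * n - 4)" "n - (n - 2) = 2"
    using n by auto
  have "card ({1..n} - {a, b}) = n - 2"
    using V dist by (subst card_Diff_subset) auto
  then have "measure_pmf.prob (random_digraph n p) (arc_free (out_cut n ({1..n} - {a, b})))
      = (1 - p / 2) ^ (2 * n - 4)"
    using prob_out_cut[of p "{1..n} - {a, b}" n] p exps by (simp add: mult.commute)
  moreover have "card {s, t} = 2"
    using dist by simp
  then have "measure_pmf.prob (random_digraph n p) (arc_free (out_cut n {s, t}))
      = (1 - p / 2) ^ (2 * n - 4)"
    using prob_out_cut[of p "{s, t}" n] p V by (simp only: exps) auto
  moreover have "measure_pmf.prob (random_digraph n p) (no_out_no_in n {s} {b})
      = (1 - p / 2) * (1 - p / 2) ^ (2 * n - 4)"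
    "measure_pmf.prob (random_digraph n p) (no_out_no_in n {t} {a})
      = (1 - p / 2) * (1 - p / 2) ^ (2 * n - 4)"
    using p V dist exps(2) by (auto simp: prob_no_out_no_in)
  ultimately show ?thesis
    by (simp add: algebra_simps)
qed

text \<open>Deleting the four special vertices from the stars makes them loopless and makes the
  out-stars disjoint from the in-stars; three stars of \<open>n - 4\<close> arcs each
  remain.\<close>

lemma prob_three_stars_le:
  assumes p: "0 \<le> p" "p \<le> 1" and X: "X \<subseteq> arc_free (A \<times> W \<union> W \<times> B)"
    and W: "W = {1..n} - Q" "Q \<subseteq> {1..n}" "card Q = 4" "A \<subseteq> Q" "B \<subseteq> Q" "card A + card B = 3"
  shows "measure_pmf.prob (random_digraph n p) X \<le> (1 - p / 2) ^ (3 * n - 12)"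
proof -
  have fin: "finite Q" "finite A" "finite B" "finite W"
    using W finite_subset[of _ Q] finite_subset[OF W(2)] by auto
  have "card W = n - 4"
    using W fin by (simp add: card_Diff_subset)
  moreover have "(A \<times> W) \<inter> (W \<times> B) = {}"
    using W by auto
  ultimately have "card (A \<times> W \<union> W \<times> B) = (card A + card B) * (n - 4)"
    using fin by (simp add: card_Un_disjoint card_cartesian_product add_mult_distrib mult.commute)
  then have "3 * n - 12 \<le> card (A \<times> W \<union> W \<times> B)"
    using W(6) by simp
  moreover have "A \<times> W \<union> W \<times> B \<subseteq> {1..n} \<times> {1..n} - Id"
    using W by auto
  ultimately have "measure_pmf.prob (random_digraph n p) (arc_free (A \<times> W \<union> W \<times> B))
      \<le> (1 - p / 2) ^ (3 * n - 12)"
    using p by (intro prob_arc_free_le) auto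
  then show ?thesis
    using measure_pmf.finite_measure_mono[OF X] order_trans by fastforce
qed

text \<open>Bonferroni: from the sum of the four probabilities subtract the six pairwise
  intersections, each of which forces three stars to be absent.\<close>

lemma prob_typical_ge:
  fixes p :: real
  assumes p: "0 < p" "p \<le> 1"
    and dist: "distinct [a, s, b, t]" and V: "{a, s, b, t} \<subseteq> {1..n}"
  shows "measure_pmf.prob (random_digraph n p) (typical n s a t b)
    \<ge> (4 - p) * (1 - p / 2) ^ (2 * n - 4) - 6 * (1 - p / 2) ^ (3 * n - 12)"
proof -
  let ?P = "measure_pmf.prob (random_digraph n p)"
  define W where "W = {1..n} - {a, s, b, t}"
  define M1 M2 M3 M4 where M: "M1 = arc_free (out_cut n {s, t})"
    "M2 = arc_free (out_cut n ({1..n} - {a, b}))"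
    "M3 = no_out_no_in n {s} {b}" "M4 = no_out_no_in n {t} {a}"
  have Un: "?P (X \<union> Y) = ?P X + ?P Y - ?P (X \<inter> Y)" for X Y
    by (rule measure_Un3) (auto simp: measure_pmf.fmeasurable_eq_sets)
  have Un_le: "?P (X \<union> Y) \<le> ?P X + ?P Y" for X Y
    by (rule measure_Un_le) auto
  note star = prob_three_stars_le[OF less_imp_le[OF p(1)] p(2) _ W_def V]
  \<comment> \<open>Each event removes two of the four stars out of \<open>s\<close>, out of
    \<open>t\<close>, into \<open>a\<close>, into \<open>b\<close>. The pairs differ, so any two
    events together remove at least three.\<close>
  have sub: "M1 \<subseteq> arc_free ({s} \<times> W)" "M1 \<subseteq> arc_free ({t} \<times> W)"
    "M2 \<subseteq> arc_free (W \<times> {a})" "M2 \<subseteq> arc_free (W \<times> {b})"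
    "M3 \<subseteq> arc_free ({s} \<times> W)" "M3 \<subseteq> arc_free (W \<times> {b})"
    "M4 \<subseteq> arc_free ({t} \<times> W)" "M4 \<subseteq> arc_free (W \<times> {a})"
    unfolding M no_out_no_in_def W_def
    by (rule arc_free_antimono; use V in \<open>force simp: out_cut_def\<close>)+
  have split: "arc_free ({s, t} \<times> W) = arc_free ({s} \<times> W) \<inter> arc_free ({t} \<times> W)"
    "arc_free (W \<times> {a, b}) = arc_free (W \<times> {a}) \<inter> arc_free (W \<times> {b})"
    unfolding arc_free_Un[symmetric] by (rule arg_cong[where f = arc_free], blast)+
  have Q: "card {a, s, b, t} = 4"
    using dist by simp
  have sub2: "M1 \<inter> M2 \<subseteq> arc_free ({s, t} \<times> W \<union> W \<times> {a})"
    "M3 \<inter> M4 \<subseteq> arc_free ({s, t} \<times> W \<union> W \<times> {a})"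
    "M1 \<inter> M3 \<subseteq> arc_free ({s, t} \<times> W \<union> W \<times> {b})"
    "M1 \<inter> M4 \<subseteq> arc_free ({s, t} \<times> W \<union> W \<times> {a})"
    "M2 \<inter> M3 \<subseteq> arc_free ({s} \<times> W \<union> W \<times> {a, b})"
    "M2 \<inter> M4 \<subseteq> arc_free ({t} \<times> W \<union> W \<times> {a, b})"
    unfolding arc_free_Un split using sub by blast+
  have small:
    "?P (M1 \<inter> M2) \<le> (1 - p / 2) ^ (3 * n - 12)"
    "?P (M3 \<inter> M4) \<le> (1 - p / 2) ^ (3 * n - 12)"
    "?P (M1 \<inter> M3) \<le> (1 - p / 2) ^ (3 * n - 12)"
    "?P (M1 \<inter> M4) \<le> (1 - p / 2) ^ (3 * n - 12)"
    "?P (M2 \<inter> M3) \<le> (1 - p / 2) ^ (3 * n - 12)"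
    "?P (M2 \<inter> M4) \<le> (1 - p / 2) ^ (3 * n - 12)"
    subgoal by (rule star[OF sub2(1) Q]; use dist in simp)
    subgoal by (rule star[OF sub2(2) Q]; use dist in simp)
    subgoal by (rule star[OF sub2(3) Q]; use dist in simp)
    subgoal by (rule star[OF sub2(4) Q]; use dist in simp)
    subgoal by (rule star[OF sub2(5) Q]; use dist in simp)
    subgoal by (rule star[OF sub2(6) Q]; use dist in simp)
    done
  have "?P ((M1 \<union> M2) \<inter> (M3 \<union> M4)) \<le> ?P (M1 \<inter> M3) + ?P (M1 \<inter> M4) + ?P (M2 \<inter> M3) + ?P (M2 \<inter> M4)"
  proof -
    have "(M1 \<union> M2) \<inter> (M3 \<union> M4) = ((M1 \<inter> M3) \<union> (M1 \<inter> M4)) \<union> ((M2 \<inter> M3) \<union> (M2 \<inter> M4))"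
      by blast
    then show ?thesis
      using Un_le[of "(M1 \<inter> M3) \<union> (M1 \<inter> M4)" "(M2 \<inter> M3) \<union> (M2 \<inter> M4)"]
        Un_le[of "M1 \<inter> M3" "M1 \<inter> M4"] Un_le[of "M2 \<inter> M3" "M2 \<inter> M4"] by simp
  qed
  moreover have "typical n s a t b = (M1 \<union> M2) \<union> (M3 \<union> M4)"
    by (auto simp: typical_def M)
  ultimately show ?thesis
    using Un[of "M1 \<union> M2" "M3 \<union> M4"] Un[of M1 M2] Un[of M3 M4] small
      prob_typical_parts[OF p dist V, folded M] by simp
qed

section \<open>Union bounds for the atypical event\<close>

lemma prob_UNION_le_card:
  assumes "finite I" "\<And>i. i \<in> I \<Longrightarrow> measure_pmf.prob M (F i) \<le> c"
  shows "measure_pmf.prob M (\<Union>i\<in>I. F i) \<le> real (card I) * c"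
proof -
  have "measure_pmf.prob M (\<Union>i\<in>I. F i) \<le> (\<Sum>i\<in>I. measure_pmf.prob M (F i))"
    by (rule measure_UNION_le) (use assms in auto)
  also have "\<dots> \<le> real (card I) * c"
    by (rule sum_bounded_above) (rule assms)
  finally show ?thesis .
qed

text \<open>By symmetry assume \<open>2 * k \<le> n\<close>. Bounding the binomial by
  \<open>n ^ k\<close>, each element of the set beyond the third costs a factor \<open>n\<close> but
  gains about \<open>n / 2\<close> further powers of \<open>y\<close>, which is at most 1 in
  total.\<close>

lemma choose_mult_power_le:
  fixes y :: real
  assumes y: "0 < y" "y \<le> 1" and n: "12 \<le> n" "real n ^ 4 * y ^ n \<le> 1"
    and k: "3 \<le> k" "k \<le> n - 3"
  shows "real (n choose k) * y ^ (k * (n - k)) \<le> real n ^ 3 * y ^ (3 * n - 9)"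
proof -
  have half: "real (n choose m) * y ^ (m * (n - m)) \<le> real n ^ 3 * y ^ (3 * n - 9)"
    if m: "3 \<le> m" "2 * m \<le> n" for m
  proof -
    \<comment> \<open>Then \<open>m * (n - m) = (j + 3) * (q + 3) = 3 * n - 9 + q * j\<close>. The
      bound \<open>n \<le> 4 * q\<close> uses \<open>12 \<le> n\<close>, and explains the fourth
      power in the hypothesis: it yields \<open>n * y ^ q \<le> 1\<close>.\<close>
    define j q where "j = m - 3" and "q = n - m - 3"
    have mn: "m = j + 3" "n - m = q + 3" "n = j + q + 6" "j \<le> q" "n \<le> 4 * q"
      using m n by (auto simp: j_def q_def)
    have exps: "m * (n - m) = (3 * n - 9) + q * j"
      unfolding mn(2) by (simp add: mn(1) mn(3) algebra_simps)
    have "(real n * y ^ q) ^ 4 = real n ^ 4 * y ^ (4 * q)"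
      by (simp add: power_mult_distrib power_mult[symmetric] mult.commute)
    also have "\<dots> \<le> real n ^ 4 * y ^ n"
      using y mn(5) by (intro mult_left_mono power_decreasing) auto
    also have "\<dots> \<le> 1 ^ 4"
      using n by simp
    finally have base: "real n * y ^ q \<le> 1"
      using power_mono_iff[of "real n * y ^ q" 1 4] y by simp
    have "real (n choose m) \<le> real n ^ m"
      using binomial_le_pow[of m n] m by (metis le_add2 mult_2 of_nat_le_iff of_nat_power order_trans)
    then have "real (n choose m) * y ^ (m * (n - m)) \<le> real n ^ (j + 3) * y ^ ((3 * n - 9) + q * j)"
      unfolding exps mn(1)[symmetric] using y by (intro mult_right_mono) auto
    also have "\<dots> = real n ^ 3 * y ^ (3 * n - 9) * (real n * y ^ q) ^ j"
      by (simp add: power_add power_mult power_mult_distrib)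
    also have "\<dots> \<le> real n ^ 3 * y ^ (3 * n - 9) * 1"
      using y base by (intro mult_left_mono power_le_one) auto
    finally show ?thesis
      by simp
  qed
  show ?thesis
  proof (cases "2 * k \<le> n")
    case True
    then show ?thesis using half k by simp
  next
    case False
    then show ?thesis
      using half[of "n - k"] k binomial_symmetric[of k n] by (simp add: mult.commute)
  qed
qed

lemma prob_medium_le:
  fixes p :: real
  assumes p: "0 < p" "p \<le> 1" and n: "12 \<le> n" "real n ^ 4 * (1 - p / 2) ^ n \<le> 1"
  shows "measure_pmf.prob (random_digraph n p) (\<Union>S\<in>medium_sets n. arc_free (out_cut n S))
    \<le> real n ^ 4 * (1 - p / 2) ^ (3 * n - 9)"
proof -
  let ?P = "measure_pmf.prob (random_digraph n p)"
  have level: "?P (\<Union>S\<in>{S. S \<subseteq> {1..n} \<and> card S = k}. arc_free (out_cut n S))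
      \<le> real n ^ 3 * (1 - p / 2) ^ (3 * n - 9)" if "k \<in> {3..n - 3}" for k
  proof -
    have "?P (\<Union>S\<in>{S. S \<subseteq> {1..n} \<and> card S = k}. arc_free (out_cut n S))
        \<le> real (card {S. S \<subseteq> {1..n} \<and> card S = k}) * (1 - p / 2) ^ (k * (n - k))"
      using p by (intro prob_UNION_le_card) (auto simp: prob_out_cut)
    also have "\<dots> = real (n choose k) * (1 - p / 2) ^ (k * (n - k))"
      by (simp add: n_subsets)
    also have "\<dots> \<le> real n ^ 3 * (1 - p / 2) ^ (3 * n - 9)"
      using p n that by (intro choose_mult_power_le) auto
    finally show ?thesis .
  qed
  have "medium_sets n = (\<Union>k\<in>{3..n - 3}. {S. S \<subseteq> {1..n} \<and> card S = k})"
    by (auto simp: medium_sets_def)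
  then have "(\<Union>S\<in>medium_sets n. arc_free (out_cut n S))
      = (\<Union>k\<in>{3..n - 3}. \<Union>S\<in>{S. S \<subseteq> {1..n} \<and> card S = k}. arc_free (out_cut n S))"
    by (simp only: UN_UN_flatten)
  then have "?P (\<Union>S\<in>medium_sets n. arc_free (out_cut n S))
      \<le> real (card {3..n - 3}) * (real n ^ 3 * (1 - p / 2) ^ (3 * n - 9))"
    by (simp only:) (rule prob_UNION_le_card[OF _ level], auto)
  also have "\<dots> \<le> real n * (real n ^ 3 * (1 - p / 2) ^ (3 * n - 9))"
    using p by (intro mult_right_mono) auto
  finally show ?thesis
    by (simp add: eval_nat_numeral mult.assoc)
qed

text \<open>Sets of one or two elements have the form \<open>{u, v}\<close>, with
  \<open>u = v\<close> allowed, so four vertices determine a pair.\<close>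

lemma small_pairs_finite_card: "finite (small_pairs n) \<and> card (small_pairs n) \<le> n ^ 4"
proof -
  let ?V = "{1..n} \<times> {1..n}"
  let ?f = "\<lambda>((u :: nat, v :: nat), (w :: nat, x :: nat)). ({u, v}, {w, x})"
  have pair: "\<exists>u\<in>{1..n}. \<exists>v\<in>{1..n}. S = {u, v}" if "S \<subseteq> {1..n}" "card S \<in> {1, 2}" for S
  proof -
    have "\<exists>u v. S = {u, v}"
      using that(2) by (auto simp: card_1_singleton_iff card_2_iff)
    then show ?thesis
      using that(1) by auto
  qed
  have "small_pairs n \<subseteq> ?f ` (?V \<times> ?V)"
  proof
    fix z assume "z \<in> small_pairs n"
    then obtain S R where z: "z = (S, R)" "S \<subseteq> {1..n}" "card S \<in> {1, 2}" "R \<subseteq> {1..n}" "card R \<in> {1, 2}"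
      by (auto simp: small_pairs_def)
    then obtain u v w x where "S = {u, v}" "R = {w, x}" "u \<in> {1..n}" "v \<in> {1..n}" "w \<in> {1..n}" "x \<in> {1..n}"
      using pair by meson
    then show "z \<in> ?f ` (?V \<times> ?V)"
      unfolding z(1) by (intro image_eqI[of _ _ "((u, v), (w, x))"]) auto
  qed
  moreover have "card (?f ` (?V \<times> ?V)) \<le> n ^ 4"
    by (rule order_trans[OF card_image_le]) (auto simp: card_cartesian_product eval_nat_numeral)
  ultimately show ?thesis
    using card_mono[of "?f ` (?V \<times> ?V)" "small_pairs n"] finite_subset[of "small_pairs n"] by force
qed

text \<open>Subtracting at most \<open>card S * card R\<close> common arcs leaves at least
  \<open>3 * n - 7\<close> arcs for sizes 1 and 2, and \<open>4 * n - 12\<close> for sizes 2 and 2.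
  Opposite pairs may occur when \<open>S\<close> meets \<open>R\<close>, so only the upper bound is
  available.\<close>

lemma prob_small_pair_le:
  fixes p :: real
  assumes p: "0 < p" "p \<le> 1" and n: "9 \<le> n" and SR: "(S, R) \<in> small_pairs n"
  shows "measure_pmf.prob (random_digraph n p) (no_out_no_in n S R) \<le> (1 - p / 2) ^ (3 * n - 9)"
proof -
  have S: "S \<subseteq> {1..n}" "R \<subseteq> {1..n}" "card S \<in> {1, 2}" "card R \<in> {1, 2}" "card S + card R \<ge> 3"
    using SR by (auto simp: small_pairs_def)
  have "card (S - R) * card (R - S) \<le> card S * card R"
    using S finite_subset[of _ "{1..n}"] by (intro mult_le_mono card_mono) auto
  then have "3 * n - 9 \<le> card (out_cut n S \<union> out_cut n ({1..n} - R))"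
    using card_two_out_cuts[OF S(1,2)] S(3-5) n by auto
  then show ?thesis
    unfolding no_out_no_in_def
    using p out_cut_subset[OF S(1)] out_cut_subset[of "{1..n} - R" n]
    by (intro prob_arc_free_le) auto
qed

lemma prob_atypical_le:
  fixes p :: real
  assumes p: "0 < p" "p \<le> 1" and n: "12 \<le> n" "real n ^ 4 * (1 - p / 2) ^ n \<le> 1"
  shows "measure_pmf.prob (random_digraph n p) (atypical n) \<le> 2 * real n ^ 4 * (1 - p / 2) ^ (3 * n - 9)"
proof -
  let ?P = "measure_pmf.prob (random_digraph n p)"
  have "?P (\<Union>(S, R)\<in>small_pairs n. no_out_no_in n S R)
      \<le> real (card (small_pairs n)) * (1 - p / 2) ^ (3 * n - 9)"
    using small_pairs_finite_card[of n] prob_small_pair_le[OF p] n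
    by (intro prob_UNION_le_card) auto
  also have "\<dots> \<le> real n ^ 4 * (1 - p / 2) ^ (3 * n - 9)"
    using p small_pairs_finite_card[of n]
    by (intro mult_right_mono) (auto simp flip: of_nat_power)
  finally have "?P (\<Union>(S, R)\<in>small_pairs n. no_out_no_in n S R)
      \<le> real n ^ 4 * (1 - p / 2) ^ (3 * n - 9)" .
  moreover have "?P (atypical n) \<le> ?P (\<Union>S\<in>medium_sets n. arc_free (out_cut n S))
      + ?P (\<Union>(S, R)\<in>small_pairs n. no_out_no_in n S R)"
    unfolding atypical_def by (rule measure_Un_le) auto
  ultimately show ?thesis
    using prob_medium_le[OF p n] by simp
qed

section \<open>Error estimate and limit\<close>

lemma prob_no_dipaths_approx:
  fixes p :: real
  assumes p: "0 < p" "p \<le> 1" and n: "12 \<le> n" "real n ^ 4 * (1 - p / 2) ^ n \<le> 1"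
    and dist: "distinct [a, s, b, t]" and V: "{a, s, b, t} \<subseteq> {1..n}"
  shows "\<bar>measure_pmf.prob (random_digraph n p) (no_dipath s a \<inter> no_dipath t b)
      - (4 - p) * (1 - p / 2) ^ (2 * n - 4)\<bar> \<le> 6 * real n ^ 4 * (1 - p / 2) ^ (3 * n - 12)"
proof -
  let ?P = "measure_pmf.prob (random_digraph n p)"
  let ?E = "no_dipath s a \<inter> no_dipath t b"
  let ?y = "1 - p / 2"
  have Un_le: "?P (X \<union> Y) \<le> ?P X + ?P Y" for X Y
    by (rule measure_Un_le) auto
  \<comment> \<open>The inclusion is known only on the support of the law, hence almost-sure
    monotonicity.\<close>
  have "?P (typical n s a t b) \<le> ?P ?E"
    using typical_subset_no_dipath[OF _ _ dist V]
    by (intro measure_pmf.finite_measure_mono_AE) (auto simp: AE_measure_pmf_iff)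
  moreover have "1 * ?y ^ (3 * n - 12) \<le> real n ^ 4 * ?y ^ (3 * n - 12)"
    using p n by (intro mult_right_mono one_le_power) auto
  ultimately have lower: "(4 - p) * ?y ^ (2 * n - 4) - 6 * real n ^ 4 * ?y ^ (3 * n - 12) \<le> ?P ?E"
    using prob_typical_ge[OF p dist V] by simp
  have "?P ?E \<le> ?P (typical n s a t b \<union> atypical n)"
    using no_dipath_subset_typical[OF _ _ _ dist V] n
    by (intro measure_pmf.finite_measure_mono_AE) (auto simp: AE_measure_pmf_iff)
  also have "\<dots> \<le> (4 - p) * ?y ^ (2 * n - 4) + 2 * real n ^ 4 * ?y ^ (3 * n - 9)"
  proof -
    have "?P (typical n s a t b) \<le> (4 - p) * ?y ^ (2 * n - 4)"
      unfolding prob_typical_parts[OF p dist V, symmetric] typical_def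
      by (intro order_trans[OF Un_le] add_mono order_refl)
    then show ?thesis
      using Un_le[of "typical n s a t b" "atypical n"] prob_atypical_le[OF p n] by linarith
  qed
  also have "(4 - p) * ?y ^ (2 * n - 4) + 2 * real n ^ 4 * ?y ^ (3 * n - 9)
      \<le> (4 - p) * ?y ^ (2 * n - 4) + 6 * real n ^ 4 * ?y ^ (3 * n - 12)"
  proof -
    have "?y ^ (3 * n - 9) \<le> ?y ^ (3 * n - 12)"
      using p by (intro power_decreasing) auto
    then show ?thesis
      using p by (intro add_left_mono mult_mono) auto
  qed
  finally show ?thesis
    using lower by linarith
qed

text \<open>With \<open>w\<close> the fourth root of \<open>y\<close>, the sequence is the fourth
  power of \<open>n * w ^ n\<close>.\<close>

lemma power4_times_power_tendsto_0:
  fixes y :: real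
  assumes "0 < y" "y < 1"
  shows "(\<lambda>n. real n ^ 4 * y ^ n) \<longlonglongrightarrow> 0"
proof -
  define w where "w = root 4 y"
  have w: "0 < w" "w < 1" "w ^ 4 = y"
    using assms by (auto simp: w_def)
  have "(\<lambda>n. (real n * w ^ n) ^ 4) \<longlonglongrightarrow> 0 ^ 4"
    using w by (intro tendsto_power powser_times_n_limit_0) auto
  then show ?thesis
    unfolding w(3)[symmetric]
    by (simp add: power_mult_distrib power_mult[symmetric] mult.commute)
qed

text \<open>The vertices are sequences because constant ones would have to lie in
  \<open>{1..4}\<close> by the case \<open>n = 4\<close>; arbitrary fixed vertices are covered by
  eventually constant sequences.\<close>

theorem theorem3p2:
  fixes p y :: real and a s b t :: "nat \<Rightarrow> nat"
  assumes p: "0 < p" "p \<le> 1"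
    and y: "y = 1 - p / 2"
    and vertices: "\<And>n. n \<ge> 4 \<Longrightarrow> {a n, s n, b n, t n} \<subseteq> {1..n}"
    and distinct: "\<And>n. n \<ge> 4 \<Longrightarrow> distinct [a n, s n, b n, t n]"
  shows "(\<lambda>n. measure_pmf.prob (random_digraph n p)
                (no_dipath (s n) (a n) \<inter> no_dipath (t n) (b n)) / y ^ (2 * n - 4))
           \<longlonglongrightarrow> 4 - p"
proof -
  have y01: "0 < y" "y < 1"
    using p y by auto
  let ?Q = "\<lambda>n. measure_pmf.prob (random_digraph n p)
                (no_dipath (s n) (a n) \<inter> no_dipath (t n) (b n))"
  note lim = power4_times_power_tendsto_0[OF y01]
  have "\<forall>\<^sub>F n in sequentially. real n ^ 4 * y ^ n < 1"
    using order_tendstoD(2)[OF lim, of 1] by simp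
  then have "\<forall>\<^sub>F n in sequentially.
      norm (?Q n / y ^ (2 * n - 4) - (4 - p)) \<le> 6 / y ^ 8 * (real n ^ 4 * y ^ n)"
    using eventually_ge_at_top[of 12]
  proof eventually_elim
    case (elim n)
    \<comment> \<open>Both exponents add up to \<open>3 * n - 4\<close>; dividing the error by
      \<open>y ^ (2 * n - 4)\<close> therefore leaves \<open>y ^ n / y ^ 8\<close>, which beats
      \<open>n ^ 4\<close>.\<close>
    have "y ^ (3 * n - 12) * y ^ 8 = y ^ (2 * n - 4) * y ^ n"
      using elim by (simp flip: power_add)
    then have split: "y ^ (3 * n - 12) = y ^ (2 * n - 4) * (y ^ n / y ^ 8)"
      using y01 by (simp add: field_simps)
    have "?Q n / y ^ (2 * n - 4) - (4 - p) = (?Q n - (4 - p) * y ^ (2 * n - 4)) / y ^ (2 * n - 4)"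
      using y01 by (simp add: field_simps)
    then have "norm (?Q n / y ^ (2 * n - 4) - (4 - p))
        = \<bar>?Q n - (4 - p) * y ^ (2 * n - 4)\<bar> / y ^ (2 * n - 4)"
      using y01 by simp
    also have "\<dots> \<le> 6 * real n ^ 4 * y ^ (3 * n - 12) / y ^ (2 * n - 4)"
      using prob_no_dipaths_approx[OF p, of n "a n" "s n" "b n" "t n"] elim vertices[of n] distinct[of n] y01
      by (intro divide_right_mono) (auto simp: y)
    also have "\<dots> = 6 / y ^ 8 * (real n ^ 4 * y ^ n)"
      unfolding split using y01 by simp
    finally show ?case .
  qed
  then have "(\<lambda>n. ?Q n / y ^ (2 * n - 4) - (4 - p)) \<longlonglongrightarrow> 0"
    by (rule Lim_null_comparison) (rule tendsto_mult_right_zero[OF lim])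
  then show ?thesis
    by (simp add: LIM_zero_iff)
qed

end
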